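(* Let $X,Z,V$ represent the meta-Hahn algebra with parameters $\eta_0,\eta_1,\eta_3$ on a real vector space $\mathfrak V_N$ of dimension $N+1$ with scalar product $(\cdot,\cdot)$, and let $\{e_m\}$, $\{d^*_n\}$ be the eigenbasis of $V$ and the adjoint GEVP basis described in the context. The function $U_m(n)=(e_m,d^*_n)$ is a biorthogonal rational function that satisfies the difference equation of GEVP (generalized eigenvalue problem) type $$Y_{n,n+1}U_m(n+1)+Y_{n,n}U_m(n)+Y_{n,n-1}U_m(n-1)=-m(m-\eta_1-1)(\alpha-n)\left[-U_m(n)+a^{( * )}_nU_m(n-1)\right],$$ where $Y=XV$.
   Context: $[A,B]=AB-BA$, $\{A,B\}=AB+BA$. Representing the meta-Hahn algebra means that $$[Z,X]=Z^2+Z,\qquad [X,V]=\{V,Z\}+\eta_1X+V-\eta_1Z+\eta_0\mathcal I,\qquad [V,Z]=2X+\eta_1Z+\eta_3\mathcal I ,$$ with $\mathcal I$ the identity. $A^T$ is the transpose of $A$ with respect to the scalar product. All bases are indexed by $0,\dots,N$. $\{d_n\}$ and $\{d_n^*\}$ are the bases with $Xd_n=(\alpha-n)Zd_n$ and $X^Td^*_n=(\alpha-n)Z^Td^*_n$, $\alpha$ real, where $Z^Td^*_n=-d^*_n+a^{( * )}_nd^*_{n-1}$ and $(Zd_n,d^*_k)=w_n^{-1}\delta_{nk}$. $\{e_m\}$ and $\{e^*_m\}$ are the eigenbases of $V$ and $V^T$: $Ve_m=\nu_me_m$, $V^Te^*_m=\nu_me^*_m$, $\nu_m=-m(m-\eta_1-1)$,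 with $(e^*_k,e_m)=0$ for $k\ne m$. The operator $Y=XV$ is tridiagonal in the basis $\{d_n^*\}$, and so is $Y^T=V^TX^T$; the coefficients in the equation are those of $Y^Td^*_n=Y_{n,n+1}d^*_{n+1}+Y_{n,n}d^*_n+Y_{n,n-1}d^*_{n-1}$. Biorthogonality is with respect to the partner functions $\tilde U_k(n)=(e^*_k,Zd_n)$: $$\sum_{n=0}^N\tilde U_k(n)U_m(n)w_n=0,\qquad k\ne m.$$ *)

theory Defs
  imports "HOL-Analysis.Analysis" "HOL-Computational_Algebra.Polynomial"
begin

definition commutator :: "('a::real_vector \<Rightarrow> 'a) \<Rightarrow> ('a \<Rightarrow> 'a) \<Rightarrow> 'a \<Rightarrow> 'a" where
  "commutator A B = (\<lambda>x. A (B x) - B (A x))"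

definition anticommutator :: "('a::real_vector \<Rightarrow> 'a) \<Rightarrow> ('a \<Rightarrow> 'a) \<Rightarrow> 'a \<Rightarrow> 'a" where
  "anticommutator A B = (\<lambda>x. A (B x) + B (A x))"

definition meta_hahn_rep ::
  "real \<Rightarrow> real \<Rightarrow> real \<Rightarrow> ('a::real_vector \<Rightarrow> 'a) \<Rightarrow> ('a \<Rightarrow> 'a) \<Rightarrow> ('a \<Rightarrow> 'a) \<Rightarrow> bool" where
  "meta_hahn_rep \<eta>\<^sub>0 \<eta>\<^sub>1 \<eta>\<^sub>3 X Z V \<longleftrightarrow>
     linear X \<and> linear Z \<and> linear V \<and>
     (\<forall>x. commutator Z X x = Z (Z x) + Z x) \<and>
     (\<forall>x. commutator X V x =
        anticommutator V Z x + \<eta>\<^sub>1 *\<^sub>R X x + V x - \<eta>\<^sub>1 *\<^sub>R Z x + \<eta>\<^sub>0 *\<^sub>R x) \<and>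
     (\<forall>x. commutator V Z x = 2 *\<^sub>R X x + \<eta>\<^sub>1 *\<^sub>R Z x + \<eta>\<^sub>3 *\<^sub>R x)"

definition basis_family :: "'i set \<Rightarrow> ('i \<Rightarrow> 'a::real_vector) \<Rightarrow> bool" where
  "basis_family I b \<longleftrightarrow> inj_on b I \<and> independent (b ` I) \<and> span (b ` I) = UNIV"

definition nu :: "real \<Rightarrow> nat \<Rightarrow> real" where
  "nu \<eta>\<^sub>1 m = - real m * (real m - \<eta>\<^sub>1 - 1)"

definition U_fun :: "(nat \<Rightarrow> 'a::real_inner) \<Rightarrow> (int \<Rightarrow> 'a) \<Rightarrow> nat \<Rightarrow> int \<Rightarrow> real" where
  "U_fun e ds m n = inner (e m) (ds n)"

definition U_partner ::
  "('a::real_inner \<Rightarrow> 'a) \<Rightarrow> (nat \<Rightarrow> 'a) \<Rightarrow> (int \<Rightarrow> 'a) \<Rightarrow> nat \<Rightarrow> int \<Rightarrow> real" where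
  "U_partner Z es d k n = inner (es k) (Z (d n))"

definition biorthogonal ::
  "nat \<Rightarrow> (int \<Rightarrow> real) \<Rightarrow> (nat \<Rightarrow> int \<Rightarrow> real) \<Rightarrow> (nat \<Rightarrow> int \<Rightarrow> real) \<Rightarrow> bool" where
  "biorthogonal N w U' U \<longleftrightarrow>
     (\<forall>k\<le>N. \<forall>m\<le>N. k \<noteq> m \<longrightarrow> (\<Sum>n\<in>{0..int N}. U' k n * U m n * w n) = 0)"

text \<open>
  Rationality in the grid variable \<open>n\<close>: \<open>U\<^sub>m(n) = U\<^sub>0(n) P\<^sub>m(n) / Q\<^sub>m(n)\<close> with
  \<open>Q\<^sub>m(x) = (x - \<beta>\<^sub>0) \<dots> (x - \<beta>\<^sub>m\<^sub>-\<^sub>1)\<close> and \<open>deg P\<^sub>m \<le> m\<close>, i.e. type \<open>[m/m]\<close> with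
  prescribed poles \<open>\<beta>\<^sub>k\<close>. The degree bound and the prescribed poles are essential: without them
  every function on the finite grid is rational by interpolation. The factor \<open>U\<^sub>0(n)\<close> is
  independent of \<open>m\<close> and absorbs the free normalisation of the vectors indexed by \<open>n\<close>.
  The equation is cross-multiplied so that it also covers a pole lying on the grid.
\<close>

definition rational_family ::
  "nat \<Rightarrow> (nat \<Rightarrow> real) \<Rightarrow> (nat \<Rightarrow> int \<Rightarrow> real) \<Rightarrow> bool" where
  "rational_family N \<beta> U \<longleftrightarrow>
     (\<exists>P Q :: nat \<Rightarrow> real poly. \<forall>m\<le>N.
        degree (P m) \<le> m \<and> Q m = (\<Prod>k<m. [:- \<beta> k, 1:]) \<and>
        (\<forall>n\<in>{0..int N}. U m n * poly (Q m) (of_int n) = U 0 n * poly (P m) (of_int n)))"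

end

theory Submission
  imports Defs
begin

text \<open>
  In the basis dual to the \<open>d\<^sup>*\<^sub>n\<close> the operator \<open>L = Z + 1\<close> is a weighted shift and, by the relation
  for \<open>[V, Z]\<close>, the operator \<open>V\<close> is Hessenberg; the trace of that relation forces all weights and
  all the extreme Hessenberg entries to be nonzero. Hence an eigenvector of \<open>V\<close> is determined by its
  product with \<open>d\<^sup>*\<^sub>0\<close>, so the \<open>\<nu>\<^sub>m\<close> are pairwise distinct, and the representation is irreducible.
  Distinctness makes \<open>X\<close> and \<open>Z\<close> tridiagonal in the basis \<open>e\<^sub>m\<close>, and irreducibility makes the
  subdiagonal entries of \<open>Z\<close> nonzero. The generalized eigenvalue equation then is a three-term
  recurrence in \<open>m\<close> whose leading coefficient vanishes at \<open>n = \<alpha> + m\<close>, which yields rationality.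
\<close>

section \<open>Expansions in dual bases\<close>

lemma basis_family_orthogonal_eq_0:
  fixes b :: "'i \<Rightarrow> 'a::real_inner"
  assumes "basis_family I b" "\<And>i. i \<in> I \<Longrightarrow> inner v (b i) = 0"
  shows "v = 0"
proof -
  have "v \<in> span (b ` I)"
    using assms(1) by (simp add: basis_family_def)
  then have "orthogonal v v"
    by (rule orthogonal_to_span) (use assms(2) in \<open>auto simp: orthogonal_def\<close>)
  then show ?thesis by (simp add: orthogonal_self)
qed

text \<open>The residual of the first expansion is orthogonal to the basis \<open>b\<close> and
  hence zero. The second expansion follows by pairing \<open>v\<close> with an arbitrary vector
  written in the first form.\<close>

lemma biorthonormal_expansion:
  fixes b g :: "'i \<Rightarrow> 'a::real_inner"
  assumes "finite I" "basis_family I b"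
    and gb: "\<And>i j. i \<in> I \<Longrightarrow> j \<in> I \<Longrightarrow> inner (g i) (b j) = (if i = j then 1 else 0)"
  shows "v = (\<Sum>i\<in>I. inner v (b i) *\<^sub>R g i)"
    and "v = (\<Sum>i\<in>I. inner (g i) v *\<^sub>R b i)"
proof -
  have exp: "u = (\<Sum>i\<in>I. inner u (b i) *\<^sub>R g i)" for u
  proof -
    define r where "r = u - (\<Sum>i\<in>I. inner u (b i) *\<^sub>R g i)"
    have rb: "inner r (b j) = 0" if "j \<in> I" for j
    proof -
      have "(\<Sum>i\<in>I. inner u (b i) * inner (g i) (b j))
          = (\<Sum>i\<in>I. if i = j then inner u (b i) else 0)"
        using that by (intro sum.cong) (auto simp: gb)
      then show ?thesis
        using that \<open>finite I\<close> by (simp add: r_def inner_diff_left inner_sum_left sum.delta)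
    qed
    have "r = 0"
      using basis_family_orthogonal_eq_0[OF assms(2)] rb by blast
    then show ?thesis by (simp add: r_def)
  qed
  show "v = (\<Sum>i\<in>I. inner v (b i) *\<^sub>R g i)" by (rule exp)
  have "inner u v = inner u (\<Sum>i\<in>I. inner (g i) v *\<^sub>R b i)" for u
    by (subst exp[of u]) (simp add: inner_sum_left inner_sum_right mult.commute)
  then show "v = (\<Sum>i\<in>I. inner (g i) v *\<^sub>R b i)"
    by (metis vector_eq_rdot inner_commute)
qed

section \<open>Rationality from a three-term recurrence in the degree\<close>

text \<open>Multiplying the recurrence by \<open>Q m\<close> turns each term on the right into
  \<open>U 0 n\<close> times a polynomial of degree at most \<open>m + 1\<close>. On the left the
  root \<open>\<beta> m\<close> of the leading coefficient supplies the new factor of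
  \<open>Q (Suc m)\<close>.\<close>

lemma rational_family_recurrence:
  assumes c: "\<And>m. m < N \<Longrightarrow> c m \<noteq> 0"
    and rec: "\<And>m n. m < N \<Longrightarrow> n \<in> {0..int N} \<Longrightarrow>
      c m * (of_int n - \<beta> m) * U (Suc m) n
        = (p m + q m * of_int n) * U m n
          + (if m = 0 then 0 else (r m + s m * of_int n) * U (m - 1) n)"
  shows "rational_family N \<beta> U"
proof -
  define Q where "Q m = (\<Prod>k<m. [:- \<beta> k, 1:])" for m
  have "\<exists>P. degree P \<le> m \<and> (\<forall>n\<in>{0..int N}. U m n * poly (Q m) (of_int n) = U 0 n * poly P (of_int n))"
    if "m \<le> N" for m
    using that
  proof (induction m rule: less_induct)
    case (less m)
    show ?case
    proof (cases m)
      case 0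
      then show ?thesis by (intro exI[of _ 1]) (simp add: Q_def)
    next
      case (Suc i)
      then have i: "i < N" using less.prems by simp
      obtain P1 where P1: "degree P1 \<le> i"
          "\<And>n. n \<in> {0..int N} \<Longrightarrow> U i n * poly (Q i) (of_int n) = U 0 n * poly P1 (of_int n)"
        using less.IH[of i] Suc i by auto
      \<comment> \<open>The term of index \<open>i - 1\<close> has the smaller denominator
        \<open>Q (i - 1)\<close>; the missing factor \<open>x - \<beta> (i - 1)\<close> raises the
        degree of its numerator to at most \<open>i\<close>. At \<open>i = 0\<close> the term is set
        to 0, which avoids truncated subtraction.\<close>
      obtain P2 where P2: "degree P2 \<le> i"
          "\<And>n. n \<in> {0..int N} \<Longrightarrow>
            (if i = 0 then 0 else U (i - 1) n) * poly (Q i) (of_int n) = U 0 n * poly P2 (of_int n)"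
      proof (cases i)
        case 0
        then show ?thesis using that[of 0] by simp
      next
        case (Suc l)
        then obtain P0 where P0: "degree P0 \<le> l"
            "\<And>n. n \<in> {0..int N} \<Longrightarrow> U l n * poly (Q l) (of_int n) = U 0 n * poly P0 (of_int n)"
          using less.IH[of l] \<open>m = Suc i\<close> i by auto
        have "degree ([:- \<beta> l, 1:] * P0) \<le> i"
          using P0(1) Suc degree_mult_le[of "[:- \<beta> l, 1:]" P0] by simp
        moreover have "U l n * poly (Q i) (of_int n) = U 0 n * poly ([:- \<beta> l, 1:] * P0) (of_int n)"
          if "n \<in> {0..int N}" for n
        proof -
          have "U l n * poly (Q i) (of_int n)
              = (of_int n - \<beta> l) * (U l n * poly (Q l) (of_int n))"
            by (simp add: Q_def Suc algebra_simps)
          then show ?thesis by (simp add: P0(2)[OF that] algebra_simps)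
        qed
        ultimately show ?thesis using that Suc by simp
      qed
      define P where "P = smult (1 / c i) ([:p i, q i:] * P1 + [:r i, s i:] * P2)"
      have "degree ([:p i, q i:] * P1) \<le> Suc i"
        using P1(1) degree_mult_le[of "[:p i, q i:]" P1] by (auto split: if_splits)
      moreover have "degree ([:r i, s i:] * P2) \<le> Suc i"
        using P2(1) degree_mult_le[of "[:r i, s i:]" P2] by (auto split: if_splits)
      ultimately have "degree P \<le> m"
        unfolding P_def Suc using degree_smult_le degree_add_le le_trans by blast
      moreover have "U m n * poly (Q m) (of_int n) = U 0 n * poly P (of_int n)"
        if n: "n \<in> {0..int N}" for n
      proof -
        have "c i * (U m n * poly (Q m) (of_int n))
            = (c i * (of_int n - \<beta> i) * U (Suc i) n) * poly (Q i) (of_int n)"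
          by (simp add: Q_def Suc algebra_simps)
        also have "\<dots> = (p i + q i * of_int n) * (U i n * poly (Q i) (of_int n))
            + (r i + s i * of_int n) * ((if i = 0 then 0 else U (i - 1) n) * poly (Q i) (of_int n))"
          unfolding rec[OF i n] by (cases "i = 0") (simp_all add: ring_distribs mult_ac)
        also have "\<dots> = c i * (U 0 n * poly P (of_int n))"
          unfolding P1(2)[OF n] P2(2)[OF n] using c[OF i] by (simp add: P_def field_simps)
        finally show ?thesis using c[OF i] by simp
      qed
      ultimately show ?thesis by blast
    qed
  qed
  then obtain P where "\<And>m. m \<le> N \<Longrightarrow> degree (P m) \<le> m \<and>
      (\<forall>n\<in>{0..int N}. U m n * poly (Q m) (of_int n) = U 0 n * poly (P m) (of_int n))"
    by metis
  then show ?thesis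
    unfolding rational_family_def by (intro exI[of _ P] exI[of _ Q]) (simp add: Q_def)
qed

section \<open>Selection rule for matrix entries between eigenvectors of V\<close>

text \<open>Here \<open>x\<close> and \<open>z\<close> stand for the entries of X and Z at
  \<open>(k, m)\<close> in an eigenbasis of V, and the hypotheses are the off-diagonal entries of
  the relations for [V,Z] and [X,V].\<close>

lemma nu_coupling:
  fixes k m :: nat
  assumes eqZ: "(nu \<eta> k - nu \<eta> m) * z = 2 * x + \<eta> * z"
    and eqX: "(nu \<eta> m - nu \<eta> k) * x = (nu \<eta> k + nu \<eta> m) * z + \<eta> * x - \<eta> * z"
    and "z \<noteq> 0"
  shows "k = Suc m \<or> m = Suc k \<or> real k + real m = \<eta> \<or> real k + real m = \<eta> + 2"
proof -
  have x: "x = (nu \<eta> k - nu \<eta> m - \<eta>) * z / 2"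
    using eqZ by (simp add: field_simps)
  \<comment> \<open>With p = k - m and q = k + m - \<eta> - 1, the difference of the eigenvalues is
    -pq and twice their sum is (\<eta> + 1)^2 - p^2 - q^2. Eliminating \<open>x\<close> then leaves
    (p^2 - 1)(q^2 - 1) z = 0.\<close>
  have "((real k - real m)\<^sup>2 - 1) * ((real k + real m - \<eta> - 1)\<^sup>2 - 1) * z = 0"
    using eqX unfolding x nu_def by (simp add: field_simps power2_eq_square)
  then have "(real k - real m)\<^sup>2 = 1\<^sup>2 \<or> (real k + real m - \<eta> - 1)\<^sup>2 = 1\<^sup>2"
    using \<open>z \<noteq> 0\<close> by simp
  then show ?thesis
    unfolding power2_eq_iff by auto
qed

section \<open>A weighted shift and a Hessenberg operator\<close>

text \<open>This is the relation for [V,Z] with X eliminated: paired with \<open>ds j\<close>, X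
  becomes a multiple of Z that depends on \<open>j\<close>, so \<open>comm\<close> involves only V
  and the shift \<open>L\<close>.\<close>

locale hessenberg_shift_pair =
  fixes V L :: "'a::real_inner \<Rightarrow> 'a" and ds f :: "nat \<Rightarrow> 'a" and a :: "nat \<Rightarrow> real"
    and N :: nat and \<kappa> \<mu> :: real
  assumes linear_V: "linear V"
    and f_ds: "\<And>j k. j \<le> N \<Longrightarrow> k \<le> N \<Longrightarrow> inner (f k) (ds j) = (if k = j then 1 else 0)"
    and expansion: "\<And>v. v = (\<Sum>k\<le>N. inner v (ds k) *\<^sub>R f k)"
    and L_ds_0: "\<And>v. inner (L v) (ds 0) = 0"
    and L_ds_Suc: "\<And>v j. j < N \<Longrightarrow> inner (L v) (ds (Suc j)) = a (Suc j) * inner v (ds j)"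
    and comm: "\<And>v j. j \<le> N \<Longrightarrow> inner (V (L v) - L (V v)) (ds j)
      = (\<mu> - 2 * real j) * inner (L v) (ds j) + (\<kappa> + 2 * real j) * inner v (ds j)"
begin

lemma eqI: "(\<And>j. j \<le> N \<Longrightarrow> inner x (ds j) = inner y (ds j)) \<Longrightarrow> x = y"
  using expansion[of x] expansion[of y] by (metis (no_types, lifting) atMost_iff sum.cong)

lemma L_f: "k < N \<Longrightarrow> L (f k) = a (Suc k) *\<^sub>R f (Suc k)"
  and L_f_last: "L (f N) = 0"
proof -
  show "L (f k) = a (Suc k) *\<^sub>R f (Suc k)" if "k < N"
  proof (rule eqI)
    fix j assume "j \<le> N"
    then show "inner (L (f k)) (ds j) = inner (a (Suc k) *\<^sub>R f (Suc k)) (ds j)"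
      using that by (cases j) (auto simp: L_ds_0 L_ds_Suc f_ds)
  qed
  show "L (f N) = 0"
  proof (rule eqI)
    fix j assume "j \<le> N"
    then show "inner (L (f N)) (ds j) = inner 0 (ds j)"
      by (cases j) (auto simp: L_ds_0 L_ds_Suc f_ds)
  qed
qed

lemma L_f_V: "k < N \<Longrightarrow> inner (V (L (f k))) (ds j) = a (Suc k) * inner (V (f (Suc k))) (ds j)"
  "inner (V (L (f N))) (ds j) = 0"
  using linear_V by (simp_all add: L_f L_f_last linear_cmul linear_0)

text \<open>The shift has zero diagonal, so the diagonal entries of \<open>comm\<close> say that
  consecutive products differ by \<open>\<kappa> + 2 * real k\<close>. Summing from the top gives
  \<open>(real k + 1) * (real k + \<kappa>)\<close>, and the last entry fixes
  \<open>\<kappa>\<close>.\<close>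

lemma weight_times_superdiagonal:
  assumes "k < N"
  shows "a (Suc k) * inner (V (f (Suc k))) (ds k) = - (real k + 1) * (real N - real k)"
proof -
  have step: "a (Suc k) * inner (V (f (Suc k))) (ds k)
      = (real k + 1) * (real k + \<kappa>)" if "k < N" for k
    using that
  proof (induction k)
    case 0
    then show ?case
      using comm[of 0 "f 0"] by (simp add: inner_diff_left L_f_V L_ds_0 f_ds)
  next
    case (Suc k)
    have "a (Suc (Suc k)) * inner (V (f (Suc (Suc k)))) (ds (Suc k))
        - a (Suc k) * inner (V (f (Suc k))) (ds k) = \<kappa> + 2 * real (Suc k)"
      using Suc.prems comm[of "Suc k" "f (Suc k)"]
      by (simp add: inner_diff_left L_f_V L_ds_Suc f_ds)
    moreover have "a (Suc k) * inner (V (f (Suc k))) (ds k) = (real k + 1) * (real k + \<kappa>)"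
      using Suc by simp
    ultimately show ?case by (simp add: algebra_simps)
  qed
  obtain n where n: "N = Suc n" using assms by (cases N) auto
  \<comment> \<open>Since \<open>L\<close> kills \<open>f N\<close>, the last diagonal entry has
    only one product. This is the trace condition, and it forces
    \<open>\<kappa> = - real N\<close>.\<close>
  have "- (a N * inner (V (f N)) (ds n)) = \<kappa> + 2 * real N"
    using comm[of N "f N", unfolded L_f_last linear_0[OF linear_V]] n L_ds_Suc[of n "V (f N)"]
    by (simp add: inner_diff_left f_ds)
  then have "(real n + 2) * (real N + \<kappa>) = 0"
    using step[of n] n by (simp add: algebra_simps)
  then have "\<kappa> = - real N"
    by (smt (verit) mult_eq_0_iff of_nat_0_le_iff)
  then show ?thesis
    using step[OF assms] by (simp add: algebra_simps)
qed

lemma weight_nonzero: "k < N \<Longrightarrow> a (Suc k) \<noteq> 0"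
  and superdiagonal_nonzero: "k < N \<Longrightarrow> inner (V (f (Suc k))) (ds k) \<noteq> 0"
proof -
  assume "k < N"
  then have "- (real k + 1) * (real N - real k) \<noteq> 0" by simp
  then show "a (Suc k) \<noteq> 0" "inner (V (f (Suc k))) (ds k) \<noteq> 0"
    using weight_times_superdiagonal[OF \<open>k < N\<close>] by auto
qed

text \<open>Above the diagonal the right side of \<open>comm\<close> vanishes, so entry
  \<open>(j, k)\<close> of V is a multiple of entry \<open>(j + 1, k + 1)\<close>. The last column
  starts the induction, since \<open>L\<close> kills \<open>f N\<close>.\<close>

lemma hessenberg: "Suc j < k \<Longrightarrow> k \<le> N \<Longrightarrow> inner (V (f k)) (ds j) = 0"
proof (induction "N - k" arbitrary: j k)
  case 0
  then have [simp]: "k = N" by simp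
  show ?case
    using 0 comm[of "Suc j" "f N"] weight_nonzero[of j]
    by (simp add: inner_diff_left L_f_V L_ds_Suc f_ds)
next
  case (Suc i)
  then have k: "k < N" by simp
  have "inner (V (f (Suc k))) (ds (Suc j)) = 0"
    using Suc k by simp
  then show ?case
    using Suc.prems k comm[of "Suc j" "f k"] weight_nonzero[of j]
    by (simp add: inner_diff_left L_f_V L_ds_Suc f_ds)
qed

text \<open>Row \<open>i\<close> of the eigenvalue equation expresses coordinate
  \<open>i + 1\<close> through the earlier ones, because the superdiagonal entry is nonzero.\<close>

lemma eigenvector_eq_0:
  assumes "V x = \<nu> *\<^sub>R x" "inner x (ds 0) = 0"
  shows "x = 0"
proof (rule eqI)
  fix j assume "j \<le> N"
  then have "inner x (ds j) = 0"
  proof (induction j rule: less_induct)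
    case (less j)
    show ?case
    proof (cases j)
      case 0
      then show ?thesis using assms by simp
    next
      case (Suc i)
      have "V x = (\<Sum>k\<le>N. inner x (ds k) *\<^sub>R V (f k))"
        by (subst expansion[of x]) (simp add: linear_sum[OF linear_V] linear_cmul[OF linear_V])
      then have "\<nu> * inner x (ds i) = (\<Sum>k\<le>N. inner x (ds k) * inner (V (f k)) (ds i))"
        using arg_cong[OF assms(1), of "\<lambda>y. inner y (ds i)"] by (simp add: inner_sum_left)
      also have "\<dots> = (\<Sum>k\<le>N. if k = j then inner x (ds j) * inner (V (f j)) (ds i) else 0)"
      proof (intro sum.cong refl)
        fix k assume "k \<in> {..N}"
        then consider "k < j" | "k = j" | "Suc i < k" "k \<le> N" using Suc by force
        then show "inner x (ds k) * inner (V (f k)) (ds i)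
            = (if k = j then inner x (ds j) * inner (V (f j)) (ds i) else 0)"
          using less Suc by cases (auto simp: hessenberg)
      qed
      also have "\<dots> = inner x (ds j) * inner (V (f j)) (ds i)"
        using less.prems by simp
      finally show ?thesis
        using less Suc superdiagonal_nonzero[of i] by simp
    qed
  qed
  then show "inner x (ds j) = inner 0 (ds j)" by simp
qed

text \<open>The first nonzero coordinate of \<open>(L ^^ j) x\<close> is the one at
  \<open>j\<close>, since no weight vanishes. Subtracting multiples of these powers clears the
  coordinates of any vector one after another.\<close>

lemma invariant_subspace_eq_UNIV:
  assumes S: "subspace S" "\<And>v. v \<in> S \<Longrightarrow> L v \<in> S" and x: "x \<in> S" "inner x (ds 0) \<noteq> 0"
  shows "S = UNIV"
proof -
  have pow: "(L ^^ j) x \<in> S \<and> (\<forall>k<j. inner ((L ^^ j) x) (ds k) = 0) \<and> inner ((L ^^ j) x) (ds j) \<noteq> 0"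
    if "j \<le> N" for j
    using that
  proof (induction j)
    case 0
    then show ?case using x by simp
  next
    case (Suc j)
    have "inner ((L ^^ Suc j) x) (ds k) = 0" if "k < Suc j" for k
      using that Suc by (cases k) (auto simp: L_ds_0 L_ds_Suc)
    then show ?case
      using Suc S(2) weight_nonzero[of j] by (auto simp: L_ds_Suc)
  qed
  have "v \<in> S" if "j \<le> Suc N" "\<forall>k<j. inner v (ds k) = 0" for j v
    using that
  proof (induction "Suc N - j" arbitrary: j v)
    case 0
    then have "v = 0" by (intro eqI) auto
    then show ?case using S(1) by (simp add: subspace_0)
  next
    case (Suc i)
    then have j: "j \<le> N" by simp
    define u where "u = (L ^^ j) x"
    define t where "t = inner v (ds j) / inner u (ds j)"
    have u: "u \<in> S" "\<forall>k<j. inner u (ds k) = 0" "inner u (ds j) \<noteq> 0"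
      using pow[OF j] by (auto simp: u_def)
    have "\<forall>k<Suc j. inner (v - t *\<^sub>R u) (ds k) = 0"
      using Suc.prems u by (auto simp: less_Suc_eq inner_diff_left t_def)
    then have "v - t *\<^sub>R u \<in> S"
      using Suc j by (intro Suc.hyps(1)[of "Suc j"]) auto
    then show ?case
      using u(1) S(1) by (metis diff_add_cancel subspace_add subspace_scale)
  qed
  from this[of 0] show ?thesis by auto
qed

end


theorem proposition5p2:
  fixes X Z V :: "'a::euclidean_space \<Rightarrow> 'a"
    and \<eta>\<^sub>0 \<eta>\<^sub>1 \<eta>\<^sub>3 \<alpha> :: real
    and N :: nat
    and d ds :: "int \<Rightarrow> 'a"
    and e es :: "nat \<Rightarrow> 'a"
    and a w :: "int \<Rightarrow> real"
    and Y :: "int \<Rightarrow> int \<Rightarrow> real"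
  assumes dim: "DIM('a) = N + 1"
    and rep: "meta_hahn_rep \<eta>\<^sub>0 \<eta>\<^sub>1 \<eta>\<^sub>3 X Z V"
    and d_basis: "basis_family {0..int N} d"
    and d_gevp: "\<And>n. n \<in> {0..int N} \<Longrightarrow> X (d n) = (\<alpha> - of_int n) *\<^sub>R Z (d n)"
    and ds_basis: "basis_family {0..int N} ds"
    and ds_boundary: "ds (- 1) = 0" "ds (int N + 1) = 0"
    and ds_gevp: "\<And>n. n \<in> {0..int N} \<Longrightarrow>
          adjoint X (ds n) = (\<alpha> - of_int n) *\<^sub>R adjoint Z (ds n)"
    and Z_ds: "\<And>n. n \<in> {0..int N} \<Longrightarrow> adjoint Z (ds n) = - ds n + a n *\<^sub>R ds (n - 1)"
    and w_nz: "\<And>n. n \<in> {0..int N} \<Longrightarrow> w n \<noteq> 0"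
    and d_ds: "\<And>n k. n \<in> {0..int N} \<Longrightarrow> k \<in> {0..int N} \<Longrightarrow>
          inner (Z (d n)) (ds k) = (if n = k then inverse (w n) else 0)"
    and e_basis: "basis_family {0..N} e"
    and e_eigen: "\<And>m. m \<le> N \<Longrightarrow> V (e m) = nu \<eta>\<^sub>1 m *\<^sub>R e m"
    and es_basis: "basis_family {0..N} es"
    and es_eigen: "\<And>m. m \<le> N \<Longrightarrow> adjoint V (es m) = nu \<eta>\<^sub>1 m *\<^sub>R es m"
    and es_e: "\<And>k m. k \<le> N \<Longrightarrow> m \<le> N \<Longrightarrow> k \<noteq> m \<Longrightarrow> inner (es k) (e m) = 0"
    and Y_ds: "\<And>n. n \<in> {0..int N} \<Longrightarrow>
          adjoint (X \<circ> V) (ds n) =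
            Y n (n + 1) *\<^sub>R ds (n + 1) + Y n n *\<^sub>R ds n + Y n (n - 1) *\<^sub>R ds (n - 1)"
  shows "rational_family N (\<lambda>k. \<alpha> + real k) (U_fun e ds)
       \<and> biorthogonal N w (U_partner Z es d) (U_fun e ds)
       \<and> (\<forall>m\<le>N. \<forall>n\<in>{0..int N}.
            Y n (n + 1) * U_fun e ds m (n + 1) + Y n n * U_fun e ds m n
              + Y n (n - 1) * U_fun e ds m (n - 1)
            = - real m * (real m - \<eta>\<^sub>1 - 1) * (\<alpha> - of_int n)
              * (- U_fun e ds m n + a n * U_fun e ds m (n - 1)))"
proof -

  \<comment> \<open>The operators in the basis dual to the adjoint GEVP basis\<close>
  have linX: "linear X" and linZ: "linear Z" and linV: "linear V"
    and relXV: "\<And>x. X (V x) - V (X x)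
      = V (Z x) + Z (V x) + \<eta>\<^sub>1 *\<^sub>R X x + V x - \<eta>\<^sub>1 *\<^sub>R Z x + \<eta>\<^sub>0 *\<^sub>R x"
    and relVZ: "\<And>x. V (Z x) - Z (V x) = 2 *\<^sub>R X x + \<eta>\<^sub>1 *\<^sub>R Z x + \<eta>\<^sub>3 *\<^sub>R x"
    using rep by (auto simp: meta_hahn_rep_def commutator_def anticommutator_def)
  have adjX: "inner (X v) y = inner v (adjoint X y)"
    and adjZ: "inner (Z v) y = inner v (adjoint Z y)"
    and adjV: "inner (V v) y = inner v (adjoint V y)" for v y
    using adjoint_works linX linZ linV by metis+
  have X_ds: "inner (X v) (ds n) = (\<alpha> - of_int n) * inner (Z v) (ds n)"
    if "n \<in> {0..int N}" for v n
    by (simp add: adjX adjZ ds_gevp[OF that])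

  define L where "L v = Z v + v" for v
  have L_ds: "inner (L v) (ds n) = a n * inner v (ds (n - 1))" if "n \<in> {0..int N}" for v n
    by (simp add: L_def inner_add_left adjZ Z_ds[OF that] inner_diff_right inner_add_right)

  \<comment> \<open>The factor \<open>w n\<close> normalises \<open>Z (d n)\<close> to the dual
    basis of \<open>ds\<close>.\<close>
  define f where "f n = w n *\<^sub>R Z (d n)" for n
  have f_ds: "inner (f n) (ds k) = (if n = k then 1 else 0)"
    if "n \<in> {0..int N}" "k \<in> {0..int N}" for n k
    using that d_ds w_nz by (simp add: f_def)
  have f_exp: "v = (\<Sum>n\<in>{0..int N}. inner v (ds n) *\<^sub>R f n)" for v
    by (rule biorthonormal_expansion(1)[OF _ ds_basis f_ds]) auto
  have int_image: "{0..int N} = int ` {..N}"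
    by (simp add: atMost_atLeast0 image_int_atLeastAtMost)

  \<comment> \<open>Both constants come from putting X = (\<alpha> - j) Z and Z = L - 1 into 2X +
    \<open>\<eta>\<^sub>1\<close> Z + \<open>\<eta>\<^sub>3\<close> after pairing with
    \<open>ds j\<close>.\<close>
  interpret hessenberg_shift_pair V L "\<lambda>k. ds (int k)" "\<lambda>k. f (int k)" "\<lambda>k. a (int k)" N
    "\<eta>\<^sub>3 - \<eta>\<^sub>1 - 2 * \<alpha>" "2 * \<alpha> + \<eta>\<^sub>1"
  proof (rule hessenberg_shift_pair.intro)
    show "v = (\<Sum>k\<le>N. inner v (ds (int k)) *\<^sub>R f (int k))" for v
      by (subst f_exp[of v]) (simp add: int_image sum.reindex)
    show "inner (V (L v) - L (V v)) (ds (int j))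
      = (2 * \<alpha> + \<eta>\<^sub>1 - 2 * real j) * inner (L v) (ds (int j))
        + (\<eta>\<^sub>3 - \<eta>\<^sub>1 - 2 * \<alpha> + 2 * real j) * inner v (ds (int j))" if "j \<le> N" for v j
    proof -
      have "V (L v) - L (V v) = 2 *\<^sub>R X v + \<eta>\<^sub>1 *\<^sub>R Z v + \<eta>\<^sub>3 *\<^sub>R v"
        by (simp add: L_def linear_add[OF linV] flip: relVZ)
      then show ?thesis
        using that by (simp add: L_def inner_add_left X_ds algebra_simps)
    qed
  qed (use linV f_ds L_ds ds_boundary in auto)

  \<comment> \<open>The eigenbasis of V, its dual, and distinctness of the eigenvalues\<close>
  have e_nz: "e m \<noteq> 0" if "m \<le> N" for m
    using e_basis that unfolding basis_family_def by (metis atLeastAtMost_iff dependent_zero image_eqI zero_le)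
  have ee: "inner (es k) (e k) \<noteq> 0" if "k \<le> N" for k
  proof
    assume "inner (es k) (e k) = 0"
    then have "inner (es k) (e m) = 0" if "m \<le> N" for m
      using es_e[OF \<open>k \<le> N\<close> that] by (cases "k = m") auto
    then have "es k = 0"
      using basis_family_orthogonal_eq_0[OF e_basis] by simp
    then show False
      using es_basis that unfolding basis_family_def
      by (metis atLeastAtMost_iff dependent_zero image_eqI zero_le)
  qed
  define g where "g k = (1 / inner (es k) (e k)) *\<^sub>R es k" for k
  have g_e: "inner (g k) (e m) = (if k = m then 1 else 0)" if "k \<le> N" "m \<le> N" for k m
    using that ee es_e by (simp add: g_def)
  have e_exp: "v = (\<Sum>k\<le>N. inner (g k) v *\<^sub>R e k)" for v
    unfolding atMost_atLeast0 by (rule biorthonormal_expansion(2)[OF _ e_basis g_e]) auto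
  have g_V: "inner (g k) (V v) = nu \<eta>\<^sub>1 k * inner (g k) v" if "k \<le> N" for k v
  proof -
    have "inner (es k) (V v) = inner v (adjoint V (es k))"
      by (metis adjV inner_commute)
    then show ?thesis
      by (simp add: g_def es_eigen[OF that] inner_commute[of v])
  qed

  have nu_inj: "k = m" if "k \<le> N" "m \<le> N" "nu \<eta>\<^sub>1 k = nu \<eta>\<^sub>1 m" for k m
  proof (rule ccontr)
    assume "k \<noteq> m"
    \<comment> \<open>If two eigenvalues agree, this combination is again an eigenvector, chosen
      orthogonal to \<open>ds 0\<close>; hence it is zero. Its \<open>e k\<close> coefficient then
      shows that \<open>e m\<close> is orthogonal to \<open>ds 0\<close>, so
      \<open>e m = 0\<close>.\<close>
    define x where "x = inner (e m) (ds 0) *\<^sub>R e k - inner (e k) (ds 0) *\<^sub>R e m"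
    have "V x = nu \<eta>\<^sub>1 k *\<^sub>R x"
      using that by (simp add: x_def linear_diff[OF linV] linear_cmul[OF linV] e_eigen algebra_simps)
    moreover have "inner x (ds (int 0)) = 0"
      by (simp add: x_def inner_diff_left)
    ultimately have "x = 0"
      by (rule eigenvector_eq_0)
    moreover have "inner (g k) x = inner (e m) (ds 0)"
      using that \<open>k \<noteq> m\<close> by (simp add: x_def inner_diff_right g_e)
    ultimately have "inner (e m) (ds (int 0)) = 0"
      by simp
    then show False
      using eigenvector_eq_0[OF e_eigen[OF \<open>m \<le> N\<close>]] e_nz[OF \<open>m \<le> N\<close>] by simp
  qed

  \<comment> \<open>Matrix entries of X and Z in the eigenbasis of V\<close>
  define z where "z k m = inner (g k) (Z (e m))" for k m
  define x where "x k m = inner (g k) (X (e m))" for k m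
  have x_z: "(nu \<eta>\<^sub>1 k - nu \<eta>\<^sub>1 m) * z k m = 2 * x k m + \<eta>\<^sub>1 * z k m"
    if "k \<le> N" "m \<le> N" "k \<noteq> m" for k m
    using arg_cong[OF relVZ[of "e m"], of "inner (g k)"] that
    by (simp add: inner_add_right inner_diff_right g_V e_eigen linear_cmul[OF linZ] g_e
        x_def z_def algebra_simps)
  have z_tridiagonal: "z k m = 0" if "k \<le> N" "m \<le> N" "k \<noteq> m" "k \<noteq> Suc m" "m \<noteq> Suc k" for k m
  proof (rule ccontr)
    assume "z k m \<noteq> 0"
    have "(nu \<eta>\<^sub>1 m - nu \<eta>\<^sub>1 k) * x k m
        = (nu \<eta>\<^sub>1 k + nu \<eta>\<^sub>1 m) * z k m + \<eta>\<^sub>1 * x k m - \<eta>\<^sub>1 * z k m"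
      using arg_cong[OF relXV[of "e m"], of "inner (g k)"] that
      by (simp add: inner_add_right inner_diff_right g_V e_eigen linear_cmul[OF linZ]
          linear_cmul[OF linX] g_e x_def z_def algebra_simps)
    from nu_coupling[OF x_z[OF that(1-3)] this \<open>z k m \<noteq> 0\<close>]
    have "real k + real m = \<eta>\<^sub>1 \<or> real k + real m = \<eta>\<^sub>1 + 2"
      using that by auto
    \<comment> \<open>Moving one of the two indices towards the other gives distinct \<open>i\<close>, \<open>j\<close> with
      \<open>i + j = \<eta>\<^sub>1 + 1\<close>, that is \<open>\<nu>\<^sub>i = \<nu>\<^sub>j\<close>.\<close>
    then obtain i j where ij: "i \<le> N" "j \<le> N" "i \<noteq> j" "real i + real j = \<eta>\<^sub>1 + 1"
    proof
      assume s: "real k + real m = \<eta>\<^sub>1"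
      show ?thesis
      proof (cases "k < m")
        case True
        then show ?thesis using that[of "Suc k" m] \<open>k \<le> N\<close> \<open>m \<le> N\<close> \<open>m \<noteq> Suc k\<close> s by simp
      next
        case False
        then show ?thesis
          using that[of k "Suc m"] \<open>k \<le> N\<close> \<open>m \<le> N\<close> \<open>k \<noteq> m\<close> \<open>k \<noteq> Suc m\<close> s by simp
      qed
    next
      assume s: "real k + real m = \<eta>\<^sub>1 + 2"
      show ?thesis
      proof (cases "k < m")
        case True
        then show ?thesis using that[of k "m - 1"] \<open>k \<le> N\<close> \<open>m \<le> N\<close> \<open>m \<noteq> Suc k\<close> s
          by (simp add: of_nat_diff)
      next
        case False
        then show ?thesis
          using that[of "k - 1" m] \<open>k \<le> N\<close> \<open>m \<le> N\<close> \<open>k \<noteq> m\<close> \<open>k \<noteq> Suc m\<close> s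
          by (simp add: of_nat_diff)
      qed
    qed
    have \<eta>: "\<eta>\<^sub>1 = real i + real j - 1" using ij(4) by simp
    have "nu \<eta>\<^sub>1 i = nu \<eta>\<^sub>1 j"
      unfolding \<eta> nu_def by (simp add: algebra_simps)
    then show False using nu_inj ij by blast
  qed

  have z_sub: "z (Suc m) m \<noteq> 0" if m: "m < N" for m
  proof
    assume zero: "z (Suc m) m = 0"
    \<comment> \<open>This is the span of \<open>e 0\<close>, ..., \<open>e m\<close>. A vanishing
      subdiagonal entry would make it invariant under \<open>L\<close>, and it contains
      \<open>e 0\<close>, which is not orthogonal to \<open>ds 0\<close>.\<close>
    define S where "S = {v. \<forall>k\<in>{m<..N}. inner (g k) v = 0}"
    have "subspace S"
      unfolding subspace_def S_def by (auto simp: inner_add_right)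
    moreover have "L v \<in> S" if v: "v \<in> S" for v
    proof -
      have "inner (g k) (Z v) = 0" if k: "m < k" "k \<le> N" for k
      proof -
        have "Z v = (\<Sum>i\<le>N. inner (g i) v *\<^sub>R Z (e i))"
          by (subst e_exp[of v]) (simp add: linear_sum[OF linZ] linear_cmul[OF linZ])
        then have "inner (g k) (Z v) = (\<Sum>i\<le>N. inner (g i) v * z k i)"
          by (simp add: inner_sum_right z_def)
        also have "\<dots> = 0"
        proof (intro sum.neutral ballI)
          fix i assume "i \<in> {..N}"
          then show "inner (g i) v * z k i = 0"
            using v k zero z_tridiagonal[of k i]
            by (cases "m < i"; cases "k = Suc m \<and> i = m") (auto simp: S_def)
        qed
        finally show ?thesis .
      qed
      then show ?thesis
        using v by (simp add: S_def L_def inner_add_right)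
    qed
    moreover have "e 0 \<in> S"
      by (simp add: S_def g_e)
    moreover have "inner (e 0) (ds (int 0)) \<noteq> 0"
      using eigenvector_eq_0[OF e_eigen[of 0]] e_nz[of 0] by auto
    ultimately have "S = UNIV"
      by (rule invariant_subspace_eq_UNIV)
    then have "e (Suc m) \<in> S" by simp
    then show False
      using m g_e[of "Suc m" "Suc m"] by (auto simp: S_def)
  qed

  \<comment> \<open>The vector X \<open>e m\<close> - (\<alpha> - n) Z \<open>e m\<close> is
    orthogonal to \<open>ds n\<close>; expanding it in the eigenbasis leaves the three neighbouring
    indices.\<close>
  have recurrence: "z (Suc m) m * (of_int n - (\<alpha> + real m)) * U_fun e ds (Suc m) n
      = (\<alpha> * z m m - x m m + - z m m * of_int n) * U_fun e ds m n
        + (if m = 0 then 0 else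
            (z (m - 1) m * (\<alpha> + \<eta>\<^sub>1 + 1 - real m) + - z (m - 1) m * of_int n)
              * U_fun e ds (m - 1) n)"
    if m: "m < N" and n: "n \<in> {0..int N}" for m n
  proof -
    define c where "c k = (x k m - (\<alpha> - of_int n) * z k m) * U_fun e ds k n" for k
    have "X (e m) - (\<alpha> - of_int n) *\<^sub>R Z (e m)
        = (\<Sum>k\<le>N. (x k m - (\<alpha> - of_int n) * z k m) *\<^sub>R e k)"
      by (subst e_exp) (simp add: inner_diff_right x_def z_def)
    then have "inner (X (e m) - (\<alpha> - of_int n) *\<^sub>R Z (e m)) (ds n) = (\<Sum>k\<le>N. c k)"
      by (simp add: inner_sum_left c_def U_fun_def)
    then have "0 = (\<Sum>k\<le>N. c k)"
      by (simp add: inner_diff_left X_ds[OF n])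
    \<comment> \<open>At \<open>m = 0\<close> the truncated index \<open>m - 1\<close> would
      coincide with \<open>m\<close>, so it is left out.\<close>
    also have "\<dots> = (\<Sum>k\<in>{m, Suc m} \<union> (if m = 0 then {} else {m - 1}). c k)"
    proof (rule sum.mono_neutral_right)
      show "\<forall>k\<in>{..N} - ({m, Suc m} \<union> (if m = 0 then {} else {m - 1})). c k = 0"
      proof
        fix k assume "k \<in> {..N} - ({m, Suc m} \<union> (if m = 0 then {} else {m - 1}))"
        then have k: "k \<le> N" "k \<noteq> m" "k \<noteq> Suc m" "m \<noteq> Suc k"
          by (auto split: if_splits)
        then show "c k = 0"
          using m x_z[of k m] z_tridiagonal[of k m] by (simp add: c_def)
      qed
    qed (use m in auto)
    also have "\<dots> = c m + c (Suc m) + (if m = 0 then 0 else c (m - 1))"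
      by auto
    finally have sum0: "0 = c m + c (Suc m) + (if m = 0 then 0 else c (m - 1))" .
    have "nu \<eta>\<^sub>1 (Suc m) - nu \<eta>\<^sub>1 m = \<eta>\<^sub>1 - 2 * real m"
      by (simp add: nu_def algebra_simps)
    then have "(\<eta>\<^sub>1 - 2 * real m) * z (Suc m) m = 2 * x (Suc m) m + \<eta>\<^sub>1 * z (Suc m) m"
      using x_z[of "Suc m" m] m by simp
    \<comment> \<open>Hence the coefficient of index \<open>m + 1\<close> is (n - \<alpha> - m)
      times \<open>z (Suc m) m\<close>, which places the pole at \<alpha> + m.\<close>
    then have up: "x (Suc m) m = - real m * z (Suc m) m"
      by (simp add: left_diff_distrib)
    have down: "x (m - 1) m = (real m - 1 - \<eta>\<^sub>1) * z (m - 1) m" if "m \<noteq> 0"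
    proof -
      have "nu \<eta>\<^sub>1 (m - 1) - nu \<eta>\<^sub>1 m = 2 * (real m - 1) - \<eta>\<^sub>1"
        using that by (simp add: nu_def of_nat_diff algebra_simps)
      then have "(2 * (real m - 1) - \<eta>\<^sub>1) * z (m - 1) m = 2 * x (m - 1) m + \<eta>\<^sub>1 * z (m - 1) m"
        using x_z[of "m - 1" m] m that by simp
      then show ?thesis by (simp add: algebra_simps)
    qed
    show ?thesis
      using sum0 up
      by (cases "m = 0") (simp_all add: c_def up down algebra_simps del: One_nat_def)
  qed

  \<comment> \<open>Rationality, biorthogonality and the difference equation\<close>
  have "rational_family N (\<lambda>k. \<alpha> + real k) (U_fun e ds)"
    using z_sub recurrence by (rule rational_family_recurrence)
  moreover have "biorthogonal N w (U_partner Z es d) (U_fun e ds)"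
    unfolding biorthogonal_def
  proof (intro allI impI)
    fix k m assume km: "k \<le> N" "m \<le> N" "k \<noteq> m"
    \<comment> \<open>The biorthogonality sum is this inner product expanded in the basis
      \<open>f\<close>; the weight \<open>w n\<close> sits inside \<open>f n\<close>.\<close>
    have "inner (es k) (e m) = (\<Sum>n\<in>{0..int N}. inner (e m) (ds n) * inner (es k) (f n))"
      by (subst f_exp[of "e m"]) (simp add: inner_sum_right)
    then show "(\<Sum>n\<in>{0..int N}. U_partner Z es d k n * U_fun e ds m n * w n) = 0"
      using es_e[OF km] by (simp add: U_partner_def U_fun_def f_def mult_ac)
  qed
  moreover have "Y n (n + 1) * U_fun e ds m (n + 1) + Y n n * U_fun e ds m n
        + Y n (n - 1) * U_fun e ds m (n - 1)
      = - real m * (real m - \<eta>\<^sub>1 - 1) * (\<alpha> - of_int n)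
        * (- U_fun e ds m n + a n * U_fun e ds m (n - 1))"
    if m: "m \<le> N" and n: "n \<in> {0..int N}" for m n
  proof -
    \<comment> \<open>The left side is the adjoint of XV acting on \<open>ds n\<close>. Moved to the
      other argument, V yields the eigenvalue and X is traded for (\<alpha> - n) Z.\<close>
    have "Y n (n + 1) * U_fun e ds m (n + 1) + Y n n * U_fun e ds m n
        + Y n (n - 1) * U_fun e ds m (n - 1) = inner (e m) (adjoint (X \<circ> V) (ds n))"
      by (simp add: Y_ds[OF n] U_fun_def inner_add_right)
    also have "\<dots> = inner (X (V (e m))) (ds n)"
      using adjoint_works[OF linear_compose[OF linV linX]] by simp
    also have "\<dots> = nu \<eta>\<^sub>1 m * ((\<alpha> - of_int n) * inner (e m) (adjoint Z (ds n)))"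
      by (simp add: e_eigen[OF m] linear_cmul[OF linX] X_ds[OF n] adjZ)
    also have "\<dots> = nu \<eta>\<^sub>1 m * ((\<alpha> - of_int n) * (- U_fun e ds m n + a n * U_fun e ds m (n - 1)))"
      by (simp add: Z_ds[OF n] U_fun_def inner_diff_right inner_add_right)
    finally show ?thesis by (simp add: nu_def)
  qed
  ultimately show ?thesis by blast
qed

end
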